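(* Let $c\ge 2$ be an integer and let $(x_n)_{n\ge 0}$ be the sequence of rational numbers defined by $x_0=1$ and $x_{n+1}=c+\dfrac{n}{x_n}$ for all $n\ge 0$. Then, for an integer $n\ge 0$, $x_n$ is an integer if and only if $n\in\{0,1\}$.
   Context: All terms $x_n$ of the sequence are positive, so the recurrence is well defined. *)

theory Defs
  imports Complex_Main
begin

end

theory Submission
  imports Defs
begin

text \<open>The positive fixed point of \<open>y \<mapsto> c + n / y\<close> is the root of \<open>y * (y - c) = n\<close>, and \<open>x n\<close>
  lies strictly between the fixed points for \<open>n - 1\<close> and \<open>n\<close> once \<open>n \<ge> 2\<close>. Thus
  \<open>x n * (x n - c)\<close> lies strictly between consecutive integers, so \<open>x n\<close> is not an integer.\<close>

text \<open>The map \<open>y \<mapsto> c + m / y\<close> is decreasing on positive \<open>y\<close>,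
  so the upper bound on \<open>y * (y - c)\<close> yields the lower bound on
  \<open>z * (z - c)\<close>, and the lower bound yields the upper one.\<close>

lemma recurrence_step_bounds:
  fixes c m y :: "'a :: linordered_field"
  assumes "1 < c" "1 \<le> m" "c \<le> y" "m - 1 \<le> y * (y - c)" "y * (y - c) < m"
  defines "z \<equiv> c + m / y"
  shows "c \<le> z" "m < z * (z - c)" "z * (z - c) < m + 1"
proof -
  have y: "1 < y" using assms by simp
  show "c \<le> z" using assms y by simp
  have z: "z * (z - c) = m * (c * y + m) / (y * y)"
    using y by (simp add: z_def field_simps)
  have "m * (y * y) < m * (c * y + m)"
    using assms by (intro mult_strict_left_mono) (auto simp: algebra_simps)
  then show "m < z * (z - c)"
    using y by (simp add: z pos_less_divide_eq)
  have "1 < c * y"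
    using less_1_mult[OF \<open>1 < c\<close> y] .
  \<comment> \<open>The right side exceeds the left by exactly \<open>c * y - 1\<close>.\<close>
  then have "m * (c * y + m) < (m + 1) * (c * y + m - 1)"
    by (simp add: algebra_simps)
  also have "\<dots> \<le> (m + 1) * (y * y)"
    using assms by (intro mult_left_mono) (auto simp: algebra_simps)
  finally show "z * (z - c) < m + 1"
    using y by (simp add: z pos_divide_less_eq)
qed

text \<open>The lower bound is only weak because \<open>x 1 = c\<close> makes it an equality at
  \<open>k = 0\<close>.\<close>

lemma recurrence_bounds:
  fixes c :: "'a :: linordered_field" and x :: "nat \<Rightarrow> 'a"
  assumes "1 < c" and rec: "\<And>k. x (Suc k) = c + of_nat k / x k"
  shows "c \<le> x (Suc k) \<and> of_nat k \<le> x (Suc k) * (x (Suc k) - c)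
    \<and> x (Suc k) * (x (Suc k) - c) < of_nat (Suc k)"
proof (induction k)
  case 0
  then show ?case by (simp add: rec[of 0])
next
  case (Suc k)
  then show ?case
    using recurrence_step_bounds[of c "of_nat (Suc k)" "x (Suc k)"] \<open>1 < c\<close>
    unfolding rec[of "Suc k"] by (auto simp: add.commute)
qed

text \<open>One further step of the recurrence turns the weak lower bound into a strict one.\<close>

lemma recurrence_lower_strict:
  fixes c :: "'a :: linordered_field" and x :: "nat \<Rightarrow> 'a"
  assumes "1 < c" and rec: "\<And>k. x (Suc k) = c + of_nat k / x k"
  shows "of_nat (Suc k) < x (Suc (Suc k)) * (x (Suc (Suc k)) - c)"
  using recurrence_step_bounds(2)[of c "of_nat (Suc k)" "x (Suc k)"]
    recurrence_bounds[of c x k, OF assms] \<open>1 < c\<close>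
  unfolding rec[of "Suc k"] by auto

theorem mainTheorem1:
  fixes c :: int and x :: "nat \<Rightarrow> rat" and n :: nat
  assumes "c \<ge> 2"
    and "x 0 = 1"
    and "\<And>k. x (Suc k) = of_int c + of_nat k / x k"
  shows "x n \<in> \<int> \<longleftrightarrow> n \<in> {0, 1}"
proof
  assume "n \<in> {0, 1}"
  then show "x n \<in> \<int>"
    using assms(2) assms(3)[of 0] by auto
next
  assume "x n \<in> \<int>"
  then obtain a where a: "x n = of_int a"
    by (rule Ints_cases)
  show "n \<in> {0, 1}"
  proof (rule ccontr)
    assume "n \<notin> {0, 1}"
    then obtain k where k: "n = Suc (Suc k)"
      by (metis One_nat_def insertCI not0_implies_Suc)
    have c: "1 < (of_int c :: rat)" using assms(1) by simp
    \<comment> \<open>Writing both bounds with \<open>of_int\<close> lets the comparison descend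
      from \<open>rat\<close> to \<open>int\<close>.\<close>
    have "(of_int (int (Suc k)) :: rat) < of_int (a * (a - c))"
      using recurrence_lower_strict[of "of_int c" x k, OF c assms(3)] a k by simp
    moreover have "(of_int (a * (a - c)) :: rat) < of_int (int (Suc (Suc k)))"
      using recurrence_bounds[of "of_int c" x "Suc k", OF c assms(3)] a k by simp
    ultimately show False unfolding of_int_less_iff by linarith
  qed
qed

end
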